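(* Let $n\ge 1$ be an integer, let $a_0,a_1,\ldots,a_n$ be independent standard normal $N(0,1)$ random variables, and let $$Q(z)=\sum_{i=0}^{n}a_i z^i$$ be the corresponding random polynomial (of degree $n$ almost surely). Let $p\in[0,1)$ and let $c>1$ be a real number such that $$c\ge 1+\tan\!\left(\frac{\pi}{2}\,p^{1/n}\right).$$ Then $c$ is a probabilistic bound for the roots of $Q(z)$ with probability at least $p$, that is, $$\mathbb{P}\bigl(\text{all complex roots of } Q \text{ lie in the disc } |z|\le c\bigr)\ge p .$$
   Context: A positive number $c$ is called a probabilistic bound for the roots of a random polynomial with probability at least $p$ if, with probability at least $p$, all complex roots of the polynomial lie in the closed disc $\{z\in\mathbb{C}:|z|\le c\}$. The probability is taken with respect to the law of the random coefficients. *)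

theory Defs
  imports
    "HOL-Probability.Probability"
    "HOL-Computational_Algebra.Polynomial"
begin

definition random_poly :: "nat \<Rightarrow> (nat \<Rightarrow> 'a \<Rightarrow> real) \<Rightarrow> 'a \<Rightarrow> complex poly" where
  "random_poly n a \<omega> = (\<Sum>i\<le>n. monom (complex_of_real (a i \<omega>)) i)"

text \<open>
  When \<open>p > 0\<close> the inequality forces the event to be measurable, since \<open>measure\<close> is \<open>0\<close> on
  non-measurable sets. Where the random polynomial vanishes identically, every complex number is
  a root, so such outcomes lie outside the event.
\<close>

definition prob_root_bound :: "'a measure \<Rightarrow> ('a \<Rightarrow> complex poly) \<Rightarrow> real \<Rightarrow> real \<Rightarrow> bool" where
  "prob_root_bound M Q c p \<longleftrightarrow>
     c > 0 \<and> \<P>(\<omega> in M. \<forall>z. poly (Q \<omega>) z = 0 \<longrightarrow> z \<in> cball 0 c) \<ge> p"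

end

theory Submission
  imports Defs
begin

text \<open>
  Write \<open>t = c - 1\<close>.  By Cauchy's classical bound, all roots of \<open>Q\<close> lie in the disc of radius
  \<open>1 + t = c\<close> as soon as \<open>a\<^sub>n \<noteq> 0\<close> and \<open>\<bar>a\<^sub>i\<bar> \<le> t * \<bar>a\<^sub>n\<bar>\<close> for all \<open>i < n\<close>
  (\<open>cauchy_root_bound\<close>), and \<open>a\<^sub>n \<noteq> 0\<close> almost surely.  So it suffices to bound the probability of
  these \<open>n\<close> inequalities from below.

  The \<open>n\<close> inequalities are not independent, since they share \<open>a\<^sub>n\<close>, but they are independent and
  equally likely once \<open>a\<^sub>n = y\<close> is fixed.  If \<open>G r\<close> is the probability that a standard normal
  variable has absolute value at most \<open>r\<close>, the probability in question is therefore the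
  expectation of \<open>G (t * \<bar>a\<^sub>n\<bar>) ^ n\<close>, which by Jensen's inequality is at least \<open>q ^ n\<close> with \<open>q\<close> the
  expectation of \<open>G (t * \<bar>a\<^sub>n\<bar>)\<close> (\<open>prob_all_le_multiple_of_last_ge\<close>).  This \<open>q\<close> is the
  probability that the ratio of two independent standard normal variables lies in \<open>[-t, t]\<close>.  The
  ratio has the Cauchy distribution, so \<open>q = 2 / pi * arctan t\<close> (\<open>std_normal_ratio\<close>), and the
  hypothesis on \<open>c\<close> says exactly that \<open>q ^ n \<ge> p\<close>.

  A lower bound for the probability of a subset transfers to the event about the roots only if that
  event is measurable.  It is defined by a quantifier over uncountably many points; compactness and
  separability reduce it to countably many conditions (\<open>measurable_no_zero_outside_cball\<close>).
\<close>

section \<open>A deterministic root bound\<close>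

text \<open>
  At a root of absolute value \<open>r\<close> the leading term is balanced by the others, whose total size is at
  most \<open>t * norm (b n)\<close> times the geometric sum \<open>(r ^ n - 1) / (r - 1)\<close>; for
  \<open>r - 1 > t\<close> this is too small.
\<close>

lemma cauchy_root_bound:
  fixes b :: "nat \<Rightarrow> complex" and z :: complex
  assumes lead: "b n \<noteq> 0"
    and ratio: "\<And>i. i < n \<Longrightarrow> norm (b i) \<le> t * norm (b n)"
    and "t \<ge> 0"
    and root: "(\<Sum>i\<le>n. b i * z ^ i) = 0"
  shows "norm z \<le> 1 + t"
proof (rule ccontr)
  define r where "r = norm z"
  assume "\<not> norm z \<le> 1 + t"
  then have r: "r - 1 > t" "r > 1"
    using \<open>t \<ge> 0\<close> by (auto simp: r_def)
  have "b n * z ^ n = - (\<Sum>i<n. b i * z ^ i)"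
    using root by (simp add: lessThan_Suc_atMost[symmetric] add_eq_0_iff add.commute)
  then have "norm (b n) * r ^ n = norm (\<Sum>i<n. b i * z ^ i)"
    by (metis norm_minus_cancel norm_mult norm_power r_def)
  also have "\<dots> \<le> (\<Sum>i<n. norm (b i) * r ^ i)"
    by (rule order_trans[OF norm_sum]) (simp add: norm_mult norm_power r_def)
  also have "\<dots> \<le> (\<Sum>i<n. t * norm (b n) * r ^ i)"
    by (intro sum_mono mult_right_mono) (use ratio r in auto)
  also have "\<dots> = t * norm (b n) * (\<Sum>i<n. r ^ i)"
    by (simp add: sum_distrib_left)
  finally have "(r - 1) * (norm (b n) * r ^ n) \<le> (r - 1) * (t * norm (b n) * (\<Sum>i<n. r ^ i))"
    using r by (intro mult_left_mono) auto
  also have "\<dots> = t * norm (b n) * (r ^ n - 1)"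
    by (simp add: power_diff_1_eq algebra_simps)
  also have "\<dots> \<le> t * (norm (b n) * r ^ n)"
    using \<open>t \<ge> 0\<close> by (simp add: algebra_simps)
  finally have "r - 1 \<le> t"
    by (rule mult_right_le_imp_le) (use lead r in auto)
  with r show False by simp
qed


section \<open>Measurability of events about zeros\<close>

text \<open>
  On a compact set a continuous function has a zero if and only if it takes arbitrarily small values,
  and small values, unlike zeros, can be detected on a countable dense subset.
\<close>

lemma measurable_exists_zero_compact:
  fixes f :: "'a \<Rightarrow> 'b::{metric_space, second_countable_topology} \<Rightarrow> 'c::real_normed_vector"
  assumes K: "compact K"
    and cont: "\<And>\<omega>. \<omega> \<in> space M \<Longrightarrow> continuous_on K (f \<omega>)"
    and [measurable]: "\<And>z. z \<in> K \<Longrightarrow> (\<lambda>\<omega>. f \<omega> z) \<in> borel_measurable M"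
  shows "{\<omega> \<in> space M. \<exists>z\<in>K. f \<omega> z = 0} \<in> sets M"
proof -
  obtain D where D: "countable D" "D \<subseteq> K" "K \<subseteq> closure D"
    using separable by blast
  have "(\<exists>z\<in>K. f \<omega> z = 0) \<longleftrightarrow> (\<forall>m. \<exists>z\<in>D. norm (f \<omega> z) < 1 / real (Suc m))"
    if \<omega>: "\<omega> \<in> space M" for \<omega>
  proof
    assume "\<exists>z\<in>K. f \<omega> z = 0"
    then obtain z where z: "z \<in> K" "f \<omega> z = 0" by blast
    show "\<forall>m. \<exists>z\<in>D. norm (f \<omega> z) < 1 / real (Suc m)"
    proof
      fix m
      obtain d where d: "d > 0" "\<And>x. x \<in> K \<Longrightarrow> dist x z < d \<Longrightarrow> dist (f \<omega> x) (f \<omega> z) < 1 / real (Suc m)"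
        using cont[OF \<omega>] z(1) unfolding continuous_on_iff
        by (metis of_nat_0_less_iff zero_less_Suc zero_less_divide_1_iff)
      obtain x where "x \<in> D" "dist x z < d"
        using z(1) D(3) d(1) closure_approachable by blast
      with d(2)[of x] D(2) z(2) show "\<exists>z\<in>D. norm (f \<omega> z) < 1 / real (Suc m)"
        by auto
    qed
  next
    assume approx: "\<forall>m. \<exists>z\<in>D. norm (f \<omega> z) < 1 / real (Suc m)"
    then have "K \<noteq> {}" using D(2) by blast
    then obtain z where z: "z \<in> K" "\<And>x. x \<in> K \<Longrightarrow> norm (f \<omega> z) \<le> norm (f \<omega> x)"
      using continuous_attains_inf[OF K, of "\<lambda>x. norm (f \<omega> x)"] cont[OF \<omega>]
      by (auto intro: continuous_on_norm)
    have "norm (f \<omega> z) < 1 / real (Suc m)" for m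
      using approx z(2) D(2) by (meson le_less_trans subsetD)
    then have "norm (f \<omega> z) \<le> 0"
      by (metis inverse_eq_divide linorder_not_less order_less_asym reals_Archimedean)
    with z(1) show "\<exists>z\<in>K. f \<omega> z = 0" by auto
  qed
  then have "{\<omega> \<in> space M. \<exists>z\<in>K. f \<omega> z = 0} =
      (\<Inter>m. \<Union>z\<in>D. {\<omega> \<in> space M. norm (f \<omega> z) < 1 / real (Suc m)})"
    by auto
  also have "\<dots> \<in> sets M"
  proof (rule sets.countable_INT)
    have "{\<omega> \<in> space M. norm (f \<omega> z) < 1 / real (Suc m)} \<in> sets M" if "z \<in> D" for m z
    proof -
      have "z \<in> K" using that D(2) by blast
      then show ?thesis by measurable
    qed
    then show "range (\<lambda>m. \<Union>z\<in>D. {\<omega> \<in> space M. norm (f \<omega> z) < 1 / real (Suc m)}) \<subseteq> sets M"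
      using D(1) by (auto intro!: sets.countable_UN'')
  qed simp
  finally show ?thesis .
qed

text \<open>
  The complement of a closed ball is not compact, but it is a countable union of the compact annuli
  \<open>K k\<close> below.
\<close>

lemma measurable_no_zero_outside_cball:
  fixes f :: "'a \<Rightarrow> 'b::euclidean_space \<Rightarrow> 'c::real_normed_vector"
  assumes cont: "\<And>\<omega>. \<omega> \<in> space M \<Longrightarrow> continuous_on UNIV (f \<omega>)"
    and meas: "\<And>z. (\<lambda>\<omega>. f \<omega> z) \<in> borel_measurable M"
  shows "{\<omega> \<in> space M. \<forall>z. f \<omega> z = 0 \<longrightarrow> z \<in> cball 0 c} \<in> sets M"
proof -
  define K :: "nat \<Rightarrow> 'b set" where "K = (\<lambda>k. cball 0 (real k) - ball 0 (c + 1 / real (Suc k)))"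
  have "z \<notin> cball 0 c \<longleftrightarrow> (\<exists>k. z \<in> K k)" for z
  proof
    assume "z \<notin> cball 0 c"
    then have "0 < norm z - c" by simp
    then obtain k1 where k1: "1 / real (Suc k1) < norm z - c"
      by (metis inverse_eq_divide reals_Archimedean)
    obtain k2 where k2: "norm z \<le> real k2" using real_arch_simple by blast
    have "1 / real (Suc (max k1 k2)) \<le> 1 / real (Suc k1)"
      by (intro divide_left_mono) auto
    with k1 k2 have "z \<in> K (max k1 k2)" by (auto simp: K_def)
    then show "\<exists>k. z \<in> K k" ..
  next
    assume "\<exists>k. z \<in> K k"
    then obtain k where "z \<in> K k" ..
    then have "c + 1 / real (Suc k) \<le> norm z"
      by (auto simp: K_def not_less simp del: of_nat_Suc)
    moreover have "1 / real (Suc k) > 0" by simp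
    ultimately have "c < norm z" by linarith
    then show "z \<notin> cball 0 c" by simp
  qed
  then have "{\<omega> \<in> space M. \<forall>z. f \<omega> z = 0 \<longrightarrow> z \<in> cball 0 c} =
      space M - (\<Union>k. {\<omega> \<in> space M. \<exists>z\<in>K k. f \<omega> z = 0})"
    by blast
  also have "\<dots> \<in> sets M"
  proof (intro sets.Diff sets.top sets.countable_UN'' countableI_type)
    fix k
    show "{\<omega> \<in> space M. \<exists>z\<in>K k. f \<omega> z = 0} \<in> sets M"
      by (rule measurable_exists_zero_compact)
        (auto simp: K_def intro!: compact_diff meas continuous_on_subset[OF cont])
  qed
  finally show ?thesis .
qed


section \<open>The ratio of two independent normal variables\<close>

abbreviation std_normal :: "real measure" where
  "std_normal \<equiv> density lborel (\<lambda>x. ennreal (std_normal_density x))"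

text \<open>
  At the point \<open>(y, y * s)\<close> the joint density of two independent normal variables is, for a
  fixed ratio \<open>s\<close>, again a Gaussian in \<open>y\<close>.  With the Jacobian \<open>\<bar>y\<bar>\<close> of the change to the
  coordinates \<open>(y, s)\<close>, integrating \<open>y\<close> out amounts to computing a first absolute moment.
\<close>

lemma std_normal_density_mult:
  "std_normal_density y * std_normal_density (y * s) =
    std_normal_density (sqrt (1 + s\<^sup>2) * y) / sqrt (2 * pi)"
proof -
  have "- y\<^sup>2 / 2 + - (y * s)\<^sup>2 / 2 = - (sqrt (1 + s\<^sup>2) * y)\<^sup>2 / 2"
    by (simp add: power_mult_distrib add_nonneg_nonneg algebra_simps)
  then have "exp (- y\<^sup>2 / 2) * exp (- (y * s)\<^sup>2 / 2) = exp (- (sqrt (1 + s\<^sup>2) * y)\<^sup>2 / 2)"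
    by (metis exp_add)
  then show ?thesis
    unfolding std_normal_density_def by (simp add: mult.assoc mult.left_commute)
qed

lemma nn_integral_abs_std_normal_scaled:
  assumes "r > 0"
  shows "(\<integral>\<^sup>+y. ennreal (\<bar>y\<bar> * std_normal_density (r * y)) \<partial>lborel) = ennreal (sqrt (2 / pi) / r\<^sup>2)"
    (is "?J = _")
proof -
  have "has_bochner_integral lborel (\<lambda>y. std_normal_density y * \<bar>y\<bar>) (sqrt (2 / pi))"
    using std_normal_moment_abs_odd[of 0] by simp
  then have "(\<integral>\<^sup>+y. ennreal (std_normal_density y * \<bar>y\<bar>) \<partial>lborel) = ennreal (sqrt (2 / pi))"
    by (subst nn_integral_eq_integral)
      (auto simp: has_bochner_integral_iff)
  also have "(\<integral>\<^sup>+y. ennreal (std_normal_density y * \<bar>y\<bar>) \<partial>lborel) =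
      ennreal r * (\<integral>\<^sup>+y. ennreal (std_normal_density (r * y) * \<bar>r * y\<bar>) \<partial>lborel)"
    using assms by (subst nn_integral_real_affine[where c = r and t = 0]) auto
  also have "\<dots> = ennreal (r\<^sup>2) * ?J"
    using assms
    by (simp add: nn_integral_cmult[symmetric] ennreal_mult'[symmetric] abs_mult power2_eq_square
        mult_ac)
  finally have "ennreal (1 / r\<^sup>2) * ennreal (sqrt (2 / pi)) = ennreal (1 / r\<^sup>2) * (ennreal (r\<^sup>2) * ?J)"
    by simp
  also have "\<dots> = ?J"
    using assms by (simp add: mult.assoc[symmetric] ennreal_mult'[symmetric])
  finally show ?thesis
    by (simp add: ennreal_mult'[symmetric])
qed

text \<open>
  The left-hand side is the probability that independent standard normal variables \<open>X\<close> and \<open>Y\<close>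
  satisfy \<open>\<bar>X\<bar> \<le> t * \<bar>Y\<bar>\<close>.  The substitution \<open>x = y * s\<close> in the inner integral makes its domain
  \<open>[-t, t]\<close> independent of \<open>y\<close>.  Exchanging the integrals and integrating over \<open>y\<close> first leaves
  the Cauchy density \<open>1 / (pi * (1 + s\<^sup>2))\<close>.
\<close>

lemma std_normal_ratio:
  assumes "t \<ge> 0"
  shows "(\<integral>\<^sup>+y. emeasure std_normal {x. \<bar>x\<bar> \<le> t * \<bar>y\<bar>} \<partial>std_normal) = ennreal (2 / pi * arctan t)"
proof -
  interpret std_normal: prob_space std_normal
    by (rule prob_space_normal_density) simp
  let ?\<phi> = std_normal_density
  let ?I = "indicator {-t..t} :: real \<Rightarrow> ennreal"
  have inner: "emeasure std_normal {x. \<bar>x\<bar> \<le> t * \<bar>y\<bar>} =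
      (\<integral>\<^sup>+s. ennreal (\<bar>y\<bar> * ?\<phi> (y * s)) * ?I s \<partial>lborel)" if "y \<noteq> 0" for y
  proof -
    have "\<bar>y * s\<bar> \<le> t * \<bar>y\<bar> \<longleftrightarrow> s \<in> {-t..t}" for s
      using that by (auto simp: abs_mult mult.commute)
    then have ind: "indicator {x. \<bar>x\<bar> \<le> t * \<bar>y\<bar>} (y * s) = ?I s" for s
      by (simp add: indicator_def)
    have "emeasure std_normal {x. \<bar>x\<bar> \<le> t * \<bar>y\<bar>} =
        (\<integral>\<^sup>+x. ennreal (?\<phi> x) * indicator {x. \<bar>x\<bar> \<le> t * \<bar>y\<bar>} x \<partial>lborel)"
      by (rule emeasure_density) auto
    also have "\<dots> = \<bar>y\<bar> * (\<integral>\<^sup>+s. ennreal (?\<phi> (y * s)) * ?I s \<partial>lborel)"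
      using that by (subst nn_integral_real_affine[where c = y and t = 0]) (auto simp: ind)
    also have "\<dots> = (\<integral>\<^sup>+s. ennreal (\<bar>y\<bar> * ?\<phi> (y * s)) * ?I s \<partial>lborel)"
      by (simp add: nn_integral_cmult[symmetric] ennreal_mult' mult_ac)
    finally show ?thesis .
  qed
  have meas[measurable]: "(\<lambda>y. emeasure std_normal {x. \<bar>x\<bar> \<le> t * \<bar>y\<bar>}) \<in> borel_measurable borel"
  proof -
    have "(\<lambda>y. emeasure std_normal {x. \<bar>x\<bar> \<le> t * \<bar>y\<bar>}) =
        (\<lambda>y. \<integral>\<^sup>+x. indicator {x. \<bar>x\<bar> \<le> t * \<bar>y\<bar>} x \<partial>std_normal)"
      by (subst nn_integral_indicator) auto
    also have "\<dots> \<in> borel_measurable borel"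
      unfolding indicator_def by measurable
    finally show ?thesis .
  qed
  have "(\<integral>\<^sup>+y. emeasure std_normal {x. \<bar>x\<bar> \<le> t * \<bar>y\<bar>} \<partial>std_normal) =
      (\<integral>\<^sup>+y. ennreal (?\<phi> y) * emeasure std_normal {x. \<bar>x\<bar> \<le> t * \<bar>y\<bar>} \<partial>lborel)"
    by (rule nn_integral_density) auto
  also have "\<dots> = (\<integral>\<^sup>+y. ennreal (?\<phi> y) * (\<integral>\<^sup>+s. ennreal (\<bar>y\<bar> * ?\<phi> (y * s)) * ?I s \<partial>lborel) \<partial>lborel)"
  proof (rule nn_integral_cong_AE, rule AE_mp[OF AE_lborel_singleton[of 0]], rule AE_I2, rule impI)
    fix y :: real assume "y \<noteq> 0"
    show "ennreal (?\<phi> y) * emeasure std_normal {x. \<bar>x\<bar> \<le> t * \<bar>y\<bar>} =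
        ennreal (?\<phi> y) * (\<integral>\<^sup>+s. ennreal (\<bar>y\<bar> * ?\<phi> (y * s)) * ?I s \<partial>lborel)"
      by (rule arg_cong[OF inner]) fact
  qed
  also have "\<dots> = (\<integral>\<^sup>+y. \<integral>\<^sup>+s. ennreal (\<bar>y\<bar> * ?\<phi> (sqrt (1 + s\<^sup>2) * y)) *
      (ennreal (1 / sqrt (2 * pi)) * ?I s) \<partial>lborel \<partial>lborel)"
  proof (intro nn_integral_cong)
    fix y :: real
    have "?\<phi> y * (\<bar>y\<bar> * ?\<phi> (y * s)) = \<bar>y\<bar> * (?\<phi> y * ?\<phi> (y * s))" for s
      by (rule mult.left_commute)
    then have "?\<phi> y * (\<bar>y\<bar> * ?\<phi> (y * s)) = \<bar>y\<bar> * ?\<phi> (sqrt (1 + s\<^sup>2) * y) * (1 / sqrt (2 * pi))" for s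
      unfolding std_normal_density_mult by simp
    then have "ennreal (?\<phi> y) * (ennreal (\<bar>y\<bar> * ?\<phi> (y * s)) * ?I s) =
        ennreal (\<bar>y\<bar> * ?\<phi> (sqrt (1 + s\<^sup>2) * y)) * (ennreal (1 / sqrt (2 * pi)) * ?I s)" for s
      by (simp only: mult.assoc[symmetric] ennreal_mult'[symmetric] normal_density_nonneg
          abs_ge_zero mult_nonneg_nonneg)
    then show "ennreal (?\<phi> y) * (\<integral>\<^sup>+s. ennreal (\<bar>y\<bar> * ?\<phi> (y * s)) * ?I s \<partial>lborel) =
        (\<integral>\<^sup>+s. ennreal (\<bar>y\<bar> * ?\<phi> (sqrt (1 + s\<^sup>2) * y)) * (ennreal (1 / sqrt (2 * pi)) * ?I s) \<partial>lborel)"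
      by (subst nn_integral_cmult[symmetric]) auto
  qed
  also have "\<dots> = (\<integral>\<^sup>+s. \<integral>\<^sup>+y. ennreal (\<bar>y\<bar> * ?\<phi> (sqrt (1 + s\<^sup>2) * y)) *
      (ennreal (1 / sqrt (2 * pi)) * ?I s) \<partial>lborel \<partial>lborel)"
    by (rule lborel_pair.Fubini') measurable
  also have "\<dots> = (\<integral>\<^sup>+s. ennreal (1 / (pi * (1 + s\<^sup>2))) * ?I s \<partial>lborel)"
  proof (intro nn_integral_cong)
    fix s :: real
    have pos: "1 + s\<^sup>2 > 0" by (simp add: add_pos_nonneg)
    have const: "sqrt (2 / pi) / (1 + s\<^sup>2) * (1 / sqrt (2 * pi)) = 1 / (pi * (1 + s\<^sup>2))"
      by (simp add: real_sqrt_divide real_sqrt_mult)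
    have "(\<integral>\<^sup>+y. ennreal (\<bar>y\<bar> * ?\<phi> (sqrt (1 + s\<^sup>2) * y)) * (ennreal (1 / sqrt (2 * pi)) * ?I s) \<partial>lborel)
        = ennreal (sqrt (2 / pi) / (1 + s\<^sup>2)) * (ennreal (1 / sqrt (2 * pi)) * ?I s)"
      using pos by (simp add: nn_integral_multc nn_integral_abs_std_normal_scaled)
    also have "\<dots> = ennreal (1 / (pi * (1 + s\<^sup>2))) * ?I s"
      by (subst mult.assoc[symmetric], subst ennreal_mult''[symmetric]) (simp, simp only: const)
    finally show "(\<integral>\<^sup>+y. ennreal (\<bar>y\<bar> * ?\<phi> (sqrt (1 + s\<^sup>2) * y)) *
        (ennreal (1 / sqrt (2 * pi)) * ?I s) \<partial>lborel) = ennreal (1 / (pi * (1 + s\<^sup>2))) * ?I s" .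
  qed
  also have "\<dots> = ennreal (arctan t / pi - arctan (-t) / pi)"
  proof (rule nn_integral_FTC_Icc[where F = "\<lambda>s. arctan s / pi"])
    show "((\<lambda>s. arctan s / pi) has_real_derivative 1 / (pi * (1 + s\<^sup>2))) (at s)" for s
      using DERIV_cdivide[OF DERIV_arctan, of pi s] by (simp add: inverse_eq_divide mult.commute)
  qed (use assms in auto)
  also have "arctan t / pi - arctan (-t) / pi = 2 / pi * arctan t"
    by (simp add: arctan_minus field_simps)
  finally show ?thesis .
qed


section \<open>Comparing independent variables with one of them\<close>

text \<open>
  Jensen's inequality for the power function.  Bernoulli's inequality supplies the tangent to
  \<open>x ^ n\<close> at the mean \<open>m\<close>, which stays below the graph on the closed half-line; this handles
  variables that take the value \<open>0\<close>, where convexity on an open interval would not apply directly.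
\<close>

lemma (in prob_space) expectation_power_ge:
  fixes X :: "'a \<Rightarrow> real"
  assumes int: "integrable M X" "integrable M (\<lambda>\<omega>. X \<omega> ^ n)"
    and nonneg: "\<And>\<omega>. \<omega> \<in> space M \<Longrightarrow> 0 \<le> X \<omega>"
  shows "expectation X ^ n \<le> expectation (\<lambda>\<omega>. X \<omega> ^ n)"
proof (cases "expectation X = 0")
  case True
  have "0 \<le> expectation (\<lambda>\<omega>. X \<omega> ^ n)"
    by (intro Bochner_Integration.integral_nonneg zero_le_power nonneg)
  then show ?thesis
    using True prob_space by (cases "n = 0") (auto simp: power_0_left)
next
  case False
  define m where "m = expectation X"
  have m: "m > 0"
    using False Bochner_Integration.integral_nonneg[of M X] nonneg by (auto simp: m_def less_le)
  have tangent: "m ^ n * (1 + real n * (X \<omega> / m - 1)) \<le> X \<omega> ^ n" if "\<omega> \<in> space M" for \<omega>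
  proof -
    have "1 + real n * (X \<omega> / m - 1) \<le> (1 + (X \<omega> / m - 1)) ^ n"
      using m nonneg[OF that] by (intro Bernoulli_inequality) auto
    then have "m ^ n * (1 + real n * (X \<omega> / m - 1)) \<le> m ^ n * (X \<omega> / m) ^ n"
      using m by (intro mult_left_mono) auto
    then show ?thesis using m by (simp add: power_divide)
  qed
  have "m ^ n = expectation (\<lambda>\<omega>. m ^ n * (1 + real n * (X \<omega> / m - 1)))"
    using int(1) m by (simp add: m_def[symmetric] prob_space)
  also have "\<dots> \<le> expectation (\<lambda>\<omega>. X \<omega> ^ n)"
    using int tangent by (intro integral_mono) auto
  finally show ?thesis by (simp add: m_def)
qed

text \<open>
  Conditioning on \<open>a\<^sub>n\<close>: the joint law is a product measure, so by Fubini the last coordinate \<open>y\<close> can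
  be integrated last, and for fixed \<open>y\<close> the other coordinates contribute a product of \<open>n\<close> equal
  factors.
\<close>

lemma (in prob_space) prob_all_le_multiple_of_last:
  fixes a :: "nat \<Rightarrow> 'a \<Rightarrow> real"
  assumes indep: "indep_vars (\<lambda>_. borel) a {..n}"
    and distr: "\<And>i. i \<le> n \<Longrightarrow> distr M borel (a i) = N"
  shows "emeasure M {\<omega> \<in> space M. \<forall>i<n. \<bar>a i \<omega>\<bar> \<le> t * \<bar>a n \<omega>\<bar>} =
    (\<integral>\<^sup>+y. emeasure N {x. \<bar>x\<bar> \<le> t * \<bar>y\<bar>} ^ n \<partial>N)"
proof -
  have rv: "random_variable borel (a i)" if "i \<le> n" for i
    using indep that by (auto simp: indep_vars_def)
  have N: "prob_space N"
    using prob_space_distr[OF rv[of n]] distr[of n] by simp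
  have sets_N[measurable_cong, simp]: "sets N = sets borel"
    using distr[of n] by (metis order_refl sets_distr)
  interpret N: prob_space N by (rule N)
  interpret P: product_sigma_finite "\<lambda>_::nat. N" ..
  let ?E = "{x \<in> space (PiM {..n} (\<lambda>_. N)). \<forall>i\<in>{..<n}. \<bar>x i\<bar> \<le> t * \<bar>x n\<bar>}"
  have joint: "distr M (PiM {..n} (\<lambda>_. borel)) (\<lambda>\<omega>. \<lambda>i\<in>{..n}. a i \<omega>) = PiM {..n} (\<lambda>_. N)"
  proof -
    have "PiM {..n} (\<lambda>i. distr M borel (a i)) = PiM {..n} (\<lambda>_. N)"
      by (intro PiM_cong) (auto simp: distr)
    then show ?thesis
      using indep rv indep_vars_iff_distr_eq_PiM'[of "{..n}" a "\<lambda>_. borel"] by auto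
  qed
  have setsP: "sets (PiM {..n} (\<lambda>_. N)) = sets (PiM {..n} (\<lambda>_. borel :: real measure))"
    by (intro sets_PiM_cong) auto
  have component: "(\<lambda>x. x i) \<in> borel_measurable (PiM J (\<lambda>_. N))" if "i \<in> J" for i :: nat and J
    using measurable_component_singleton[OF that, of "\<lambda>_. N"]
    by (simp add: measurable_cong_sets[OF refl sets_N])
  have E: "?E \<in> sets (PiM {..n} (\<lambda>_. N))"
  proof (intro sets.sets_Collect_finite_All finite_lessThan)
    fix i assume "i \<in> {..<n}"
    then have [measurable]: "(\<lambda>x. x i) \<in> borel_measurable (PiM {..n} (\<lambda>_. N))"
      "(\<lambda>x. x n) \<in> borel_measurable (PiM {..n} (\<lambda>_. N))"
      by (auto intro!: component)
    show "{x \<in> space (PiM {..n} (\<lambda>_. N)). \<bar>x i\<bar> \<le> t * \<bar>x n\<bar>} \<in> sets (PiM {..n} (\<lambda>_. N))"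
      by measurable
  qed
  have [measurable]: "(\<lambda>\<omega>. \<lambda>i\<in>{..n}. a i \<omega>) \<in> measurable M (PiM {..n} (\<lambda>_. borel))"
    by (intro measurable_restrict) (auto simp: rv)
  have "{\<omega> \<in> space M. \<forall>i<n. \<bar>a i \<omega>\<bar> \<le> t * \<bar>a n \<omega>\<bar>} =
      (\<lambda>\<omega>. \<lambda>i\<in>{..n}. a i \<omega>) -` ?E \<inter> space M"
    by (auto simp: space_PiM sets_eq_imp_space_eq[OF sets_N])
  also have "emeasure M \<dots> = emeasure (PiM {..n} (\<lambda>_. N)) ?E"
    using E by (subst joint[symmetric], subst emeasure_distr) (auto simp: setsP)
  also have "\<dots> = (\<integral>\<^sup>+x. indicator ?E x \<partial>PiM {..n} (\<lambda>_. N))"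
    using E by simp
  also have "\<dots> = (\<integral>\<^sup>+x. (\<Prod>i<n. indicator {u. \<bar>u\<bar> \<le> t * \<bar>x n\<bar>} (x i)) \<partial>PiM {..n} (\<lambda>_. N))"
    by (intro nn_integral_cong) (auto simp: indicator_def)
  also have "\<dots> = (\<integral>\<^sup>+x. (\<Prod>i<n. indicator {u. \<bar>u\<bar> \<le> t * \<bar>x n\<bar>} (x i)) \<partial>PiM (insert n {..<n}) (\<lambda>_. N))"
    by (simp add: lessThan_Suc_atMost[symmetric] lessThan_Suc)
  also have "\<dots> = (\<integral>\<^sup>+y. \<integral>\<^sup>+x. (\<Prod>i<n. indicator {u. \<bar>u\<bar> \<le> t * \<bar>y\<bar>} (x i)) \<partial>PiM {..<n} (\<lambda>_. N) \<partial>N)"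
  proof (subst P.product_nn_integral_insert_rev)
    show "(\<lambda>x. \<Prod>i<n. indicator {u. \<bar>u\<bar> \<le> t * \<bar>x n\<bar>} (x i) :: ennreal)
        \<in> borel_measurable (PiM (insert n {..<n}) (\<lambda>_. N))"
    proof (intro borel_measurable_prod_ennreal)
      fix i assume "i \<in> {..<n}"
      then have pair: "(\<lambda>x. (x i, x n)) \<in> measurable (PiM (insert n {..<n}) (\<lambda>_. N)) (borel \<Otimes>\<^sub>M borel)"
        by (intro measurable_Pair component) auto
      have "(\<lambda>(v, y). indicator {u. \<bar>u\<bar> \<le> t * \<bar>y\<bar>} v :: ennreal) \<in> borel_measurable (borel \<Otimes>\<^sub>M borel)"
        unfolding indicator_def by measurable
      from measurable_compose[OF pair this]
      show "(\<lambda>x. indicator {u. \<bar>u\<bar> \<le> t * \<bar>x n\<bar>} (x i) :: ennreal)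
          \<in> borel_measurable (PiM (insert n {..<n}) (\<lambda>_. N))"
        by simp
    qed
  qed (auto intro!: nn_integral_cong prod.cong)
  also have "\<dots> = (\<integral>\<^sup>+y. emeasure N {x. \<bar>x\<bar> \<le> t * \<bar>y\<bar>} ^ n \<partial>N)"
    by (subst P.product_nn_integral_prod) auto
  finally show ?thesis .
qed

lemma (in prob_space) prob_all_le_multiple_of_last_ge:
  fixes a :: "nat \<Rightarrow> 'a \<Rightarrow> real"
  assumes indep: "indep_vars (\<lambda>_. borel) a {..n}"
    and distr: "\<And>i. i \<le> n \<Longrightarrow> distr M borel (a i) = N"
    and ratio: "(\<integral>\<^sup>+y. emeasure N {x. \<bar>x\<bar> \<le> t * \<bar>y\<bar>} \<partial>N) = ennreal q" and "q \<ge> 0"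
  shows "q ^ n \<le> \<P>(\<omega> in M. \<forall>i<n. \<bar>a i \<omega>\<bar> \<le> t * \<bar>a n \<omega>\<bar>)"
proof -
  have rv: "random_variable borel (a n)"
    using indep by (auto simp: indep_vars_def)
  interpret N: prob_space N
    using prob_space_distr[OF rv] distr[of n] by simp
  have sets_N[measurable_cong, simp]: "sets N = sets borel"
    using distr[of n] by (metis order_refl sets_distr)
  define G where "G = (\<lambda>r. measure N {x. \<bar>x\<bar> \<le> r})"
  have "mono G"
    unfolding G_def by (intro monoI N.finite_measure_mono) auto
  then have [measurable]: "G \<in> borel_measurable borel"
    by (rule borel_measurable_mono)
  have nonneg: "G r \<ge> 0" and le_1: "G r \<le> 1" for r
    by (simp_all add: G_def)
  have int: "integrable N (\<lambda>y. G (t * \<bar>y\<bar>) ^ k)" for k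
    by (rule N.integrable_const_bound[where B = 1]) (simp_all add: nonneg le_1 power_le_one)
  have "ennreal q = (\<integral>\<^sup>+y. ennreal (G (t * \<bar>y\<bar>)) \<partial>N)"
    by (simp add: ratio[symmetric] G_def N.emeasure_eq_measure)
  also have "\<dots> = ennreal (N.expectation (\<lambda>y. G (t * \<bar>y\<bar>)))"
    using int[of 1] by (intro nn_integral_eq_integral) (auto simp: nonneg)
  finally have "q = N.expectation (\<lambda>y. G (t * \<bar>y\<bar>))"
    using \<open>q \<ge> 0\<close> by (subst (asm) ennreal_inj) (auto intro!: Bochner_Integration.integral_nonneg nonneg)
  then have "q ^ n \<le> N.expectation (\<lambda>y. G (t * \<bar>y\<bar>) ^ n)"
    using N.expectation_power_ge[OF int[of 1, simplified] int[of n]] nonneg by simp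
  then have "ennreal (q ^ n) \<le> ennreal (N.expectation (\<lambda>y. G (t * \<bar>y\<bar>) ^ n))"
    by (rule ennreal_leI)
  also have "\<dots> = (\<integral>\<^sup>+y. ennreal (G (t * \<bar>y\<bar>) ^ n) \<partial>N)"
    using int[of n] by (intro nn_integral_eq_integral[symmetric]) (auto simp: nonneg)
  also have "\<dots> = (\<integral>\<^sup>+y. emeasure N {x. \<bar>x\<bar> \<le> t * \<bar>y\<bar>} ^ n \<partial>N)"
    by (simp add: G_def N.emeasure_eq_measure ennreal_power)
  also have "\<dots> = emeasure M {\<omega> \<in> space M. \<forall>i<n. \<bar>a i \<omega>\<bar> \<le> t * \<bar>a n \<omega>\<bar>}"
    by (rule prob_all_le_multiple_of_last[OF indep distr, symmetric])
  finally show ?thesis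
    by (simp add: emeasure_eq_measure)
qed


section \<open>The probabilistic root bound\<close>

lemma poly_random_poly:
  "poly (random_poly n a \<omega>) z = (\<Sum>i\<le>n. complex_of_real (a i \<omega>) * z ^ i)"
  by (simp add: random_poly_def poly_sum poly_monom)

theorem theorem3:
  fixes M :: "'a measure" and a :: "nat \<Rightarrow> 'a \<Rightarrow> real" and n :: nat and p c :: real
  assumes "prob_space M"
    and "n \<ge> 1"
    and "prob_space.indep_vars M (\<lambda>_. borel) a {..n}"
    and "\<And>i. i \<le> n \<Longrightarrow> distributed M lborel (a i) std_normal_density"
    and "0 \<le> p" and "p < 1"
    and "c > 1"
    and "c \<ge> 1 + tan (pi / 2 * p powr (1 / real n))"
  shows "prob_root_bound M (random_poly n a) c p"
proof -
  interpret prob_space M by fact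
  define t where "t = c - 1"
  have t: "t > 0" "t \<ge> tan (pi / 2 * p powr (1 / real n))"
    using assms(7,8) by (auto simp: t_def)
  have rv[measurable]: "a i \<in> borel_measurable M" if "i \<le> n" for i
    using distributed_measurable[OF assms(4)[OF that]] by simp
  have distr: "distr M borel (a i) = std_normal" if "i \<le> n" for i
    using distributed_distr_eq_density[OF assms(4)[OF that]] by (simp cong: distr_cong)
  let ?ratio = "{\<omega> \<in> space M. \<forall>i<n. \<bar>a i \<omega>\<bar> \<le> t * \<bar>a n \<omega>\<bar>}"
  let ?roots = "{\<omega> \<in> space M. \<forall>z. poly (random_poly n a \<omega>) z = 0 \<longrightarrow> z \<in> cball 0 c}"
  have "p = (p powr (1 / real n)) ^ n"
    using assms(2,5) by (cases "p = 0") (auto simp: powr_realpow[symmetric] powr_powr)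
  also have "\<dots> \<le> (2 / pi * arctan t) ^ n"
  proof (intro power_mono)
    let ?x = "p powr (1 / real n)"
    have "?x < 1 powr (1 / real n)"
      using assms(2,5,6) by (intro powr_less_mono2) auto
    then have "?x < 1" by simp
    then have "arctan (tan (pi / 2 * ?x)) = pi / 2 * ?x"
      by (intro arctan_tan) (auto intro: less_le_trans[of _ 0])
    then have "pi / 2 * ?x \<le> arctan t"
      using t(2) by (metis arctan_le_iff)
    then show "?x \<le> 2 / pi * arctan t" by (simp add: field_simps)
  qed auto
  also have "\<dots> \<le> prob ?ratio"
    using t(1) by (intro prob_all_le_multiple_of_last_ge[OF assms(3) distr] std_normal_ratio) auto
  also have "\<dots> \<le> prob ?roots"
  proof (rule finite_measure_mono_AE)
    have "AE x in std_normal. x \<noteq> 0"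
      by (simp add: AE_density AE_mp[OF AE_lborel_singleton[of 0]])
    then have "AE x in distr M borel (a n). x \<noteq> 0"
      unfolding distr[OF order_refl] .
    then have "AE \<omega> in M. a n \<omega> \<noteq> 0"
      by (subst (asm) AE_distr_iff) auto
    then show "AE \<omega> in M. \<omega> \<in> ?ratio \<longrightarrow> \<omega> \<in> ?roots"
    proof (rule AE_mp, intro AE_I2 impI)
      fix \<omega> assume \<omega>: "\<omega> \<in> space M" "a n \<omega> \<noteq> 0" "\<omega> \<in> ?ratio"
      have "norm z \<le> c" if "poly (random_poly n a \<omega>) z = 0" for z
        using cauchy_root_bound[of "\<lambda>i. complex_of_real (a i \<omega>)" n t z] that \<omega> t(1)
        by (simp add: poly_random_poly t_def)
      with \<omega>(1) show "\<omega> \<in> ?roots" by simp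
    qed
    show "?roots \<in> events"
      by (rule measurable_no_zero_outside_cball)
        (auto simp: poly_random_poly intro!: continuous_intros borel_measurable_sum
          borel_measurable_times borel_measurable_of_real rv)
  qed
  finally show ?thesis
    using assms(7) by (simp add: prob_root_bound_def)
qed

end
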